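(* Let $\mathbb{K}$ be $\mathbb{R}$ or $\mathbb{C}$. The set of bi-Lipschitz maps from $[0,\infty)$ into $\mathbb{K}$ is coneable.
   Context: A map $f:[0,\infty)\to\mathbb{K}$ is bi-Lipschitz if there are $a,b>0$ with $b|x-y|\le|f(x)-f(y)|\le a|x-y|$ for all $x,y\ge0$. A subset $F$ of a vector space (here the space of all functions $[0,\infty)\to\mathbb{K}$) is coneable if it contains a convex cone generated by an infinite linearly independent set $S$, where the convex cone generated by $S$ is the set of all finite sums $\sum_{j=1}^n\lambda_j s_j$ with $n\ge1$, $\lambda_j>0$ and $s_1,\dots,s_n\in S$ distinct. *)

theory Defs
  imports Complex_Main "HOL-Library.Function_Algebras"
begin

typedef half_line = "{0::real..}"
  morphisms real_of_half_line Abs_half_line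
  by auto

text \<open>
  The space of all functions \<open>'a \<Rightarrow> 'k\<close> is a vector space over the field \<open>'k\<close>, with the
  pointwise addition of \<^theory>\<open>HOL-Library.Function_Algebras\<close> and the following scaling.
\<close>

definition fun_scale :: "'k::field \<Rightarrow> ('a \<Rightarrow> 'k) \<Rightarrow> 'a \<Rightarrow> 'k" where
  "fun_scale c f = (\<lambda>x. c * f x)"

lemma vector_space_fun_scale: "vector_space fun_scale"
  by unfold_locales (auto simp: fun_scale_def fun_eq_iff algebra_simps)

text \<open>
  The coefficients are strictly positive reals, also over the complex numbers, and the sums are
  nonempty; so, unlike the convex cones of HOL-Analysis, the generated cone need not contain 0.
\<close>

definition generated_convex_cone ::
    "('k::real_field \<Rightarrow> 'v::ab_group_add \<Rightarrow> 'v) \<Rightarrow> 'v set \<Rightarrow> 'v set" where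
  "generated_convex_cone scale S =
     {\<Sum>s\<in>T. scale (of_real (c s)) s | T c.
        finite T \<and> T \<noteq> {} \<and> T \<subseteq> S \<and> (\<forall>s\<in>T. (0::real) < c s)}"

text \<open>Linear independence is taken over the scalar field \<open>'k\<close> of the ambient vector space.\<close>

definition coneable ::
    "('k::real_field \<Rightarrow> 'v::ab_group_add \<Rightarrow> 'v) \<Rightarrow> 'v set \<Rightarrow> bool" where
  "coneable scale F \<longleftrightarrow>
     (\<exists>S. infinite S \<and> \<not> module.dependent scale S \<and> generated_convex_cone scale S \<subseteq> F)"

definition bi_lipschitz :: "(half_line \<Rightarrow> 'k::real_normed_field) \<Rightarrow> bool" where
  "bi_lipschitz f \<longleftrightarrow>
     (\<exists>a>0. \<exists>b>0. \<forall>x y.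
        b * \<bar>real_of_half_line x - real_of_half_line y\<bar> \<le> norm (f x - f y) \<and>
        norm (f x - f y) \<le> a * \<bar>real_of_half_line x - real_of_half_line y\<bar>)"

end

theory Submission imports Defs
begin

text \<open>
  The functions \<open>t \<mapsto> t + max 0 (t - (n + 1))\<close> have slopes 1 and 2 only, so a combination with
  positive coefficients of sum \<open>C\<close> has slopes between \<open>C\<close> and \<open>2 * C\<close>. The kinks lie at the
  different integers \<open>n + 1 \<ge> 1\<close>, so second differences at integer points form a biorthogonal family
  of linear functionals, which gives linear independence over any scalar field.
\<close>

lemma independent_biorthogonal:
  fixes g :: "'i \<Rightarrow> 'a \<Rightarrow> 'k::field" and D :: "'i \<Rightarrow> ('a \<Rightarrow> 'k) \<Rightarrow> 'k"
  assumes add: "\<And>i f h. D i (f + h) = D i f + D i h"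
    and scale: "\<And>i c f. D i (fun_scale c f) = c * D i f"
    and biorth: "\<And>i j. D i (g j) = (if i = j then 1 else 0)"
  shows "inj g" and "\<not> module.dependent fun_scale (range g)"
proof -
  show "inj g"
    by (rule injI) (metis biorth zero_neq_one)
  interpret V: vector_space "fun_scale :: 'k \<Rightarrow> ('a \<Rightarrow> 'k) \<Rightarrow> _"
    by (rule vector_space_fun_scale)
  have zero: "D i 0 = 0" for i
    using scale[of i 0 0] by (simp add: fun_scale_def zero_fun_def)
  \<comment> \<open>For infinite \<open>T\<close> both sums are 0 by convention, so the induction
    needs no finiteness assumption.\<close>
  have sum: "D i (\<Sum>v\<in>T. fun_scale (u v) v) = (\<Sum>v\<in>T. u v * D i v)" for i u T
    by (induction T rule: infinite_finite_induct) (simp_all only: sum.infinite sum.empty sum.insert zero add scale not_False_eq_True)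
  show "\<not> V.dependent (range g)"
  proof
    assume "V.dependent (range g)"
    then obtain T u w where T: "finite T" "T \<subseteq> range g"
      and eq: "(\<Sum>v\<in>T. fun_scale (u v) v) = 0" and w: "w \<in> T" "u w \<noteq> 0"
      unfolding V.dependent_explicit by blast
    \<comment> \<open>The functional belonging to \<open>w\<close> sends every other member of
      \<open>T\<close> to 0, so it turns the vanishing combination into the single coefficient
      \<open>u w\<close>.\<close>
    obtain i where i: "w = g i"
      using T w by blast
    have "D i v = (if v = w then 1 else 0)" if "v \<in> T" for v
      using that T i biorth by auto
    then have "(\<Sum>v\<in>T. u v * D i v) = (\<Sum>v\<in>T. if v = w then u v else 0)"
      by (intro sum.cong) auto
    also have "\<dots> = u w"
      using T w by simp
    finally show False
      using sum[of i u T] eq w zero by simp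
  qed
qed

text \<open>Lower bounds on norms do not survive addition, because increments may cancel. Signed
  real increments over ordered pairs avoid this: both of their bounds add up.\<close>

definition slopes_between :: "real \<Rightarrow> real \<Rightarrow> (half_line \<Rightarrow> 'k::real_normed_field) \<Rightarrow> bool" where
  "slopes_between b a f \<longleftrightarrow>
     (\<forall>x y. real_of_half_line x \<le> real_of_half_line y \<longrightarrow>
        (\<exists>d. f y - f x = of_real d \<and>
           b * (real_of_half_line y - real_of_half_line x) \<le> d \<and>
           d \<le> a * (real_of_half_line y - real_of_half_line x)))"

lemma slopes_between_zero: "slopes_between 0 0 0"
  unfolding slopes_between_def by auto

lemma slopes_between_add:
  assumes "slopes_between b a f" and "slopes_between b' a' g"
  shows "slopes_between (b + b') (a + a') (f + g)"
  unfolding slopes_between_def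
proof (intro allI impI)
  fix x y assume le: "real_of_half_line x \<le> real_of_half_line y"
  let ?r = "real_of_half_line y - real_of_half_line x"
  obtain d where d: "f y - f x = of_real d" "b * ?r \<le> d" "d \<le> a * ?r"
    using assms(1) le unfolding slopes_between_def by blast
  obtain e where e: "g y - g x = of_real e" "b' * ?r \<le> e" "e \<le> a' * ?r"
    using assms(2) le unfolding slopes_between_def by blast
  have "(f + g) y - (f + g) x = (f y - f x) + (g y - g x)"
    by simp
  then have "(f + g) y - (f + g) x = of_real (d + e)"
    using d e by simp
  then show "\<exists>d. (f + g) y - (f + g) x = of_real d \<and> (b + b') * ?r \<le> d \<and> d \<le> (a + a') * ?r"
    using d e by (metis add_mono distrib_right)
qed

lemma slopes_between_scale:
  assumes "slopes_between b a f" and "0 \<le> c"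
  shows "slopes_between (c * b) (c * a) (fun_scale (of_real c) f)"
  unfolding slopes_between_def
proof (intro allI impI)
  fix x y assume le: "real_of_half_line x \<le> real_of_half_line y"
  let ?r = "real_of_half_line y - real_of_half_line x" and ?g = "fun_scale (of_real c) f"
  obtain d where d: "f y - f x = of_real d" "b * ?r \<le> d" "d \<le> a * ?r"
    using assms(1) le unfolding slopes_between_def by blast
  have "?g y - ?g x = of_real (c * d)"
    using d by (simp add: fun_scale_def flip: right_diff_distrib)
  moreover have "c * b * ?r \<le> c * d" "c * d \<le> c * a * ?r"
    using d \<open>0 \<le> c\<close> by (simp_all add: mult.assoc mult_left_mono)
  ultimately show "\<exists>d. ?g y - ?g x = of_real d \<and> c * b * ?r \<le> d \<and> d \<le> c * a * ?r"
    by blast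
qed

lemma slopes_between_sum:
  assumes "\<And>s. s \<in> T \<Longrightarrow> slopes_between b a s" and "\<And>s. s \<in> T \<Longrightarrow> 0 \<le> c s"
  shows "slopes_between (sum c T * b) (sum c T * a) (\<Sum>s\<in>T. fun_scale (of_real (c s)) s)"
  using assms
  by (induction T rule: infinite_finite_induct)
    (auto simp: slopes_between_zero distrib_right intro!: slopes_between_add slopes_between_scale)

text \<open>A positive lower slope makes the increment \<open>d\<close> nonnegative for ordered
  arguments, so its norm is \<open>d\<close> itself; unordered pairs follow by symmetry.\<close>

lemma bi_lipschitz_slopes_between:
  assumes f: "slopes_between b a f" and "0 < b" and "0 < a"
  shows "bi_lipschitz f"
proof -
  have ordered: "b * \<bar>real_of_half_line x - real_of_half_line y\<bar> \<le> norm (f x - f y) \<and>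
      norm (f x - f y) \<le> a * \<bar>real_of_half_line x - real_of_half_line y\<bar>"
    if le: "real_of_half_line x \<le> real_of_half_line y" for x y
  proof -
    let ?r = "real_of_half_line y - real_of_half_line x"
    obtain d where d: "f y - f x = of_real d" "b * ?r \<le> d" "d \<le> a * ?r"
      using f le unfolding slopes_between_def by blast
    have "0 \<le> b * ?r"
      using le \<open>0 < b\<close> by simp
    with d have "norm (f x - f y) = d"
      by (subst norm_minus_commute) simp
    with d le show ?thesis
      by simp
  qed
  then have "b * \<bar>real_of_half_line x - real_of_half_line y\<bar> \<le> norm (f x - f y) \<and>
      norm (f x - f y) \<le> a * \<bar>real_of_half_line x - real_of_half_line y\<bar>" for x y
    using ordered[of x y] ordered[of y x]
    by (cases "real_of_half_line x \<le> real_of_half_line y")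
      (auto simp: norm_minus_commute abs_minus_commute)
  with \<open>0 < b\<close> \<open>0 < a\<close> show ?thesis
    unfolding bi_lipschitz_def by blast
qed

text \<open>The linear term keeps the slope at least 1 to the left of the kink, where the
  \<open>max\<close> term is constant.\<close>

definition kink :: "nat \<Rightarrow> half_line \<Rightarrow> 'k::real_normed_field" where
  "kink n x = of_real (real_of_half_line x + max 0 (real_of_half_line x - real (Suc n)))"

lemma slopes_between_kink: "slopes_between 1 2 (kink n)"
  unfolding slopes_between_def kink_def of_real_diff[symmetric]
  \<comment> \<open>With the difference folded into one \<open>of_real\<close>, \<open>refl\<close>
    picks the real increment as the witness \<open>d\<close>.\<close>
  by (intro allI impI exI conjI, rule refl) (auto simp: max_def)

text \<open>The stencil is centred at \<open>n + 1\<close>, the kink of \<open>kink n\<close>, and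
  its nodes are all nonnegative, so \<open>Abs_half_line\<close> is faithful on them.\<close>

definition second_difference :: "nat \<Rightarrow> (half_line \<Rightarrow> 'k::real_normed_field) \<Rightarrow> 'k" where
  "second_difference n f =
     f (Abs_half_line (real n)) - 2 * f (Abs_half_line (real n + 1)) + f (Abs_half_line (real n + 2))"

text \<open>Second differences annihilate affine functions. For distinct \<open>m\<close> and
  \<open>n\<close> the integer \<open>n + 1\<close> is not strictly between \<open>m\<close> and
  \<open>m + 2\<close>, so \<open>kink n\<close> is affine on the stencil; for \<open>m = n\<close>
  the value is the slope jump 1.\<close>

lemma second_difference_kink:
  "second_difference m (kink n :: half_line \<Rightarrow> 'k::real_normed_field) = (if m = n then 1 else 0)"
proof -
  let ?k = "\<lambda>t::real. t + max 0 (t - real (Suc n))"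
  have "second_difference m (kink n :: half_line \<Rightarrow> 'k) =
      of_real (?k (real m) - 2 * ?k (real m + 1) + ?k (real m + 2))"
    by (simp add: second_difference_def kink_def Abs_half_line_inverse)
  also have "?k (real m) - 2 * ?k (real m + 1) + ?k (real m + 2) = (if m = n then 1 else 0)"
    by (auto simp: max_def)
  finally show ?thesis
    by simp
qed

lemma coneable_bi_lipschitz:
  "coneable fun_scale {f :: half_line \<Rightarrow> 'k::real_normed_field. bi_lipschitz f}"
proof -
  let ?S = "range (kink :: nat \<Rightarrow> half_line \<Rightarrow> 'k)"
  have add: "second_difference n (f + h) = second_difference n f + second_difference n h"
    and scale: "second_difference n (fun_scale c f) = c * second_difference n f"
    for n c and f h :: "half_line \<Rightarrow> 'k"
    by (simp_all add: second_difference_def fun_scale_def algebra_simps)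
  note independent = independent_biorthogonal[of second_difference, OF add scale second_difference_kink]
  have "infinite ?S"
    using independent(1) using finite_imageD by blast
  moreover have "generated_convex_cone fun_scale ?S \<subseteq> {f. bi_lipschitz f}"
  proof
    fix f assume "f \<in> generated_convex_cone fun_scale ?S"
    then obtain T c where f: "f = (\<Sum>s\<in>T. fun_scale (of_real (c s)) s)"
      and T: "finite T" "T \<noteq> {}" "T \<subseteq> ?S" and c: "\<forall>s\<in>T. (0::real) < c s"
      unfolding generated_convex_cone_def by blast
    have "slopes_between (sum c T * 1) (sum c T * 2) f"
      unfolding f using T c slopes_between_kink by (intro slopes_between_sum) force+
    \<comment> \<open>Here \<open>T\<close> must be nonempty: the empty sum is the zero function,
      which is not bi-Lipschitz.\<close>
    moreover have "0 < sum c T"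
      using T c by (simp add: sum_pos)
    ultimately show "f \<in> {f. bi_lipschitz f}"
      using bi_lipschitz_slopes_between by fastforce
  qed
  ultimately show ?thesis
    using independent(2) unfolding coneable_def by blast
qed

theorem corollary5p6:
  "coneable fun_scale {f :: half_line \<Rightarrow> real. bi_lipschitz f} \<and>
   coneable fun_scale {f :: half_line \<Rightarrow> complex. bi_lipschitz f}"
  by (intro conjI coneable_bi_lipschitz)

end
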